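(* Let $n\in\mathbb{N}$. For every even integer $d\geq 2$ and every $\alpha\in\mathbb{N}$, the polynomial $$H_{d,\alpha}(x_1,x_2,\ldots,x_n)=\sum_{\substack{\boldsymbol{\pi}\vdash d\\ |\boldsymbol{\pi}|\leq\alpha}}c_{\boldsymbol{\pi}}\,h_{\boldsymbol{\pi}}(x_1,x_2,\ldots,x_n)$$ is positive definite on $\mathbb{R}^n$, in which the sum runs over all partitions $\boldsymbol{\pi}=(\pi_1,\pi_2,\ldots,\pi_r)$ of $d$ with at most $\alpha$ parts, $h_{\boldsymbol{\pi}}=h_{\pi_1}h_{\pi_2}\cdots h_{\pi_r}$ is a product of complete homogeneous symmetric polynomials, and $$c_{\boldsymbol{\pi}}=\frac{\alpha!}{(\alpha-|\boldsymbol{\pi}|)!\prod_{i\geq 1}m_i!},$$ where $|\boldsymbol{\pi}|$ denotes the number of parts in $\boldsymbol{\pi}$ and $m_i$ is the multiplicity of $i$ in $\boldsymbol{\pi}$.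
   Context: $\mathbb{N}=\{1,2,\ldots\}$. A partition of $d\in\mathbb{N}$, written $\boldsymbol{\pi}\vdash d$, is a tuple $\boldsymbol{\pi}=(\pi_1,\ldots,\pi_r)\in\mathbb{N}^r$ with $\pi_1\geq\cdots\geq\pi_r$ and $\pi_1+\cdots+\pi_r=d$; its number of parts is $|\boldsymbol{\pi}|=r$. The complete homogeneous symmetric polynomial of degree $k$ is $h_k(x_1,\ldots,x_n)=\sum_{1\leq i_1\leq\cdots\leq i_k\leq n}x_{i_1}x_{i_2}\cdots x_{i_k}$, the sum of all monomials of degree $k$ in $x_1,\ldots,x_n$. A continuous real-valued function is positive definite if it is everywhere positive, except perhaps at $0$. *)

theory Defs
  imports "HOL-Analysis.Analysis" "HOL-Library.Multiset"
begin

definition positive_definite :: "('a::{topological_space,zero} \<Rightarrow> real) \<Rightarrow> bool" where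
  "positive_definite f \<longleftrightarrow> continuous_on UNIV f \<and> (\<forall>x. x \<noteq> 0 \<longrightarrow> f x > 0)"

text \<open>
  \<open>partition_of \<pi> d\<close>: the list \<open>\<pi>\<close> of positive integers, in weakly decreasing order, is a
  partition of \<open>d\<close>. The number of parts is \<open>length \<pi>\<close>.
\<close>

definition partition_of :: "nat list \<Rightarrow> nat \<Rightarrow> bool" where
  "partition_of \<pi> d \<longleftrightarrow> (\<forall>p\<in>set \<pi>. p \<ge> 1) \<and> sorted_wrt (\<ge>) \<pi> \<and> sum_list \<pi> = d"

text \<open>
  The monomials of degree \<open>k\<close> in \<open>x\<^sub>1, \<dots>, x\<^sub>n\<close> (with \<open>n = CARD('n)\<close>) are indexed by their
  exponent vectors \<open>a\<close>. The formula in terms of weakly increasing index tuples, which needs an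
  order on the index type, is \<open>complete_homogeneous_sorted\<close> below.
\<close>

definition complete_homogeneous :: "nat \<Rightarrow> real ^ 'n \<Rightarrow> real" where
  "complete_homogeneous k x =
     (\<Sum>a | (\<Sum>i\<in>UNIV. a i) = k. \<Prod>i\<in>UNIV. (x $ i) ^ a i)"

definition complete_homogeneous_partition :: "nat list \<Rightarrow> real ^ 'n \<Rightarrow> real" where
  "complete_homogeneous_partition \<pi> x = (\<Prod>p\<leftarrow>\<pi>. complete_homogeneous p x)"

text \<open>
  Parts \<open>i\<close> that do not occur in \<open>\<pi>\<close> contribute \<open>0! = 1\<close> to the product of the \<open>m\<^sub>i!\<close>, so
  it suffices to take the product over the parts that do occur. The coefficient is only used for
  \<open>length \<pi> \<le> \<alpha>\<close>, where the subtraction does not truncate.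
\<close>

definition partition_coeff :: "nat \<Rightarrow> nat list \<Rightarrow> real" where
  "partition_coeff \<alpha> \<pi> =
     fact \<alpha> / (fact (\<alpha> - length \<pi>) * (\<Prod>i\<in>set \<pi>. fact (count_list \<pi> i)))"

definition H_poly :: "nat \<Rightarrow> nat \<Rightarrow> real ^ 'n \<Rightarrow> real" where
  "H_poly d \<alpha> x =
     (\<Sum>\<pi> | partition_of \<pi> d \<and> length \<pi> \<le> \<alpha>.
        partition_coeff \<alpha> \<pi> * complete_homogeneous_partition \<pi> x)"

text \<open>The two index sets are finite, so the sums above are genuine.\<close>

lemma finite_exponents: "finite {a :: 'n::finite \<Rightarrow> nat. (\<Sum>i\<in>UNIV. a i) = k}"
proof (rule finite_subset)
  show "{a :: 'n \<Rightarrow> nat. (\<Sum>i\<in>UNIV. a i) = k} \<subseteq> PiE UNIV (\<lambda>_. {..k})"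
    by (auto intro: member_le_sum)
  show "finite (PiE (UNIV :: 'n set) (\<lambda>_. {..k}))"
    by (intro finite_PiE) auto
qed

lemma finite_partitions: "finite {\<pi>. partition_of \<pi> d \<and> length \<pi> \<le> \<alpha>}"
proof (rule finite_subset)
  show "{\<pi>. partition_of \<pi> d \<and> length \<pi> \<le> \<alpha>} \<subseteq> {\<pi>. set \<pi> \<subseteq> {..d} \<and> length \<pi> \<le> \<alpha>}"
    by (auto simp: partition_of_def intro: member_le_sum_list)
  show "finite {\<pi>. set \<pi> \<subseteq> {..d} \<and> length \<pi> \<le> \<alpha>}"
    by (rule finite_lists_length_le) simp
qed

lemma complete_homogeneous_sorted:
  fixes x :: "real ^ 'n::{finite,linorder}"
  shows "complete_homogeneous k x =
    (\<Sum>js | sorted js \<and> length js = k. \<Prod>j\<leftarrow>js. x $ j)"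
  unfolding complete_homogeneous_def
proof (rule sum.reindex_bij_witness
    [where i = "\<lambda>js. count (mset js)" and j = "\<lambda>a. sorted_list_of_multiset (Abs_multiset a)"])
  have cnt: "count (Abs_multiset a) = a" for a :: "'n \<Rightarrow> nat"
    by (simp add: count_Abs_multiset)
  fix a :: "'n \<Rightarrow> nat" assume a: "a \<in> {a. (\<Sum>i\<in>UNIV. a i) = k}"
  show "count (mset (sorted_list_of_multiset (Abs_multiset a))) = a"
    by (simp add: cnt)
  have "size (Abs_multiset a) = (\<Sum>i\<in>UNIV. a i)"
    unfolding size_multiset_overloaded_eq cnt
    by (rule sum.mono_neutral_left) (auto simp: cnt not_in_iff)
  then show "sorted_list_of_multiset (Abs_multiset a) \<in> {js. sorted js \<and> length js = k}"
    using a by (simp add: sorted_sorted_list_of_multiset flip: size_mset)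
  have "(\<Prod>j\<leftarrow>sorted_list_of_multiset (Abs_multiset a). x $ j) =
      (\<Prod>i\<in>#Abs_multiset a. x $ i)"
    by (simp flip: prod_mset_prod_list add: mset_map)
  also have "\<dots> = (\<Prod>i\<in>set_mset (Abs_multiset a). (x $ i) ^ a i)"
    by (simp add: image_prod_mset_multiplicity cnt)
  also have "\<dots> = (\<Prod>i\<in>UNIV. (x $ i) ^ a i)"
    by (rule prod.mono_neutral_left) (auto simp: cnt not_in_iff)
  finally show "(\<Prod>j\<leftarrow>sorted_list_of_multiset (Abs_multiset a). x $ j) =
      (\<Prod>i\<in>UNIV. (x $ i) ^ a i)" .
next
  fix js :: "'n list" assume js: "js \<in> {js. sorted js \<and> length js = k}"
  then show "sorted_list_of_multiset (Abs_multiset (count (mset js))) = js"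
    by (simp add: count_inverse sorted_sort_id)
  have "(\<Sum>i\<in>UNIV. count (mset js) i) = size (mset js)"
    unfolding size_multiset_overloaded_eq
    by (rule sum.mono_neutral_right) (auto simp: not_in_iff)
  then show "count (mset js) \<in> {a. (\<Sum>i\<in>UNIV. a i) = k}"
    using js by simp
qed

end

theory Submission
  imports Defs "HOL-Computational_Algebra.Formal_Power_Series"
    "HOL-Combinatorics.Multiset_Permutations"
begin

text \<open>
  Since the generating function of the $h_k$ is $\prod_i 1/(1 - x_i t)$, the polynomial
  $H_{d,\alpha}$ is the coefficient of $t^d$ in $\prod_i 1/(1 - x_i t)^\alpha$: choosing one term from
  each of the $\alpha$ factors $\sum_k h_k t^k$ and collecting the nonzero exponents gives a
  partition of $d$ into at most $\alpha$ parts, and $c_\pi$ is the number of choices that give $\pi$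
  (\<open>H_poly_eq_nth\<close>).

  To see that this coefficient is positive, put an extra variable $y$ in: for a power series $G$ let
  $q_G(y)$ be the coefficient of $t^d$ in $G(t) e^{y t}$, so that $q_G(0)$ is the coefficient of
  $t^d$ in $G$ itself. If $G' = G/(1 - a t)$, then $q_G = q_{G'} - a q_{G'}'$, the derivative
  being taken in $y$. For even $d$ and $G(0) > 0$ the polynomial $q_{G'}$ has even degree and
  positive leading coefficient, so it attains a global minimum; the derivative vanishes there, and
  hence the minimum of $q_{G'}$ is a value of $q_G$ (\<open>appell_geometric_minimum\<close>). So positivity on
  the whole real line survives every further factor $1/(1 - a t)$, whatever the sign of $a$.

  The start is $G = 1$ with $q_1(y) = y^d/d!$, which is nonnegative but vanishes at $y = 0$.
  A first factor $1/(1 - a t)$ with $a \neq 0$ makes it strictly positive: the minimum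
  could only be zero if it were attained at $0$, where the value is $a^d > 0$. Such an $a$ exists
  among the $x_i$ exactly because $x \neq 0$.
\<close>

notation fps_nth (infixl "$$" 75)

section \<open>Positivity and multiplication by a geometric series\<close>

definition geometric_fps :: "real \<Rightarrow> real fps" where
  "geometric_fps a = Abs_fps (\<lambda>k. a ^ k)"

lemma geometric_fps_nth_0: "geometric_fps a $$ 0 = 1"
  by (simp add: geometric_fps_def)

lemma geometric_fps_mult: "geometric_fps a * (1 - fps_const a * fps_X) = 1"
proof (rule fps_ext)
  fix n
  have "geometric_fps a * (1 - fps_const a * fps_X) =
      geometric_fps a - fps_const a * (fps_X * geometric_fps a)"
    by (simp add: algebra_simps)
  then show "(geometric_fps a * (1 - fps_const a * fps_X)) $$ n = 1 $$ n"
    by (cases n) (simp_all add: geometric_fps_def)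
qed

text \<open>
  As a function of \<open>y\<close> this is the Appell polynomial
  $\sum_k G_k\, y^{d-k}/(d-k)!$. The form as a coefficient of a product turns identities between power
  series \<open>G\<close> directly into identities between these polynomials.
\<close>

definition appell :: "nat \<Rightarrow> real fps \<Rightarrow> real \<Rightarrow> real" where
  "appell d G y = (G * fps_exp y) $$ d"

lemma appell_eq_sum: "appell d G y = (\<Sum>k\<le>d. G $$ k * y ^ (d - k) / fact (d - k))"
  by (simp add: appell_def fps_mult_nth atLeast0AtMost)

lemma appell_0: "appell d G 0 = G $$ d"
  by (simp add: appell_def)

lemma appell_1: "appell d 1 y = y ^ d / fact d"
  by (simp add: appell_def)

text \<open>
  Formally, differentiating $e^{y t}$ in \<open>y\<close> multiplies it by $t$, which lowers the index by one.
\<close>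

lemma appell_has_derivative:
  "(appell (Suc d) G has_real_derivative appell d G y) (at y)"
proof -
  have "((\<lambda>y. \<Sum>k\<le>Suc d. G $$ k * y ^ (Suc d - k) / fact (Suc d - k)) has_real_derivative
      (\<Sum>k\<le>Suc d. if k \<le> d then G $$ k * y ^ (d - k) / fact (d - k) else 0)) (at y)"
  proof (rule DERIV_sum)
    fix k
    show "((\<lambda>y. G $$ k * y ^ (Suc d - k) / fact (Suc d - k)) has_real_derivative
      (if k \<le> d then G $$ k * y ^ (d - k) / fact (d - k) else 0)) (at y)"
    proof (cases "k \<le> d")
      case True
      define m where "m = d - k"
      have "((\<lambda>y. G $$ k / fact (Suc m) * y ^ Suc m) has_real_derivative
          G $$ k / fact (Suc m) * (real (Suc m) * y ^ (Suc m - Suc 0))) (at y)"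
        by (intro DERIV_cmult DERIV_pow)
      also have "G $$ k / fact (Suc m) * (real (Suc m) * y ^ (Suc m - Suc 0)) = G $$ k * y ^ m / fact m"
        by (simp add: divide_simps)
      finally show ?thesis
        using True by (simp add: m_def Suc_diff_le)
    qed simp
  qed
  moreover have "(\<Sum>k\<le>Suc d. if k \<le> d then G $$ k * y ^ (d - k) / fact (d - k) else 0)
      = appell d G y"
    by (simp add: appell_eq_sum)
  ultimately show ?thesis
    by (simp add: appell_eq_sum[abs_def])
qed

text \<open>
  This is the coefficient form of $G' = G + a t\, G'$ for $G' = G/(1 - a t)$. By
  \<open>appell_has_derivative\<close> the last term is \<open>a\<close> times the derivative of the left-hand side.
\<close>

lemma appell_geometric:
  "appell (Suc d) (geometric_fps a * G) y = appell (Suc d) G y + a * appell d (geometric_fps a * G) y"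
proof -
  have *: "geometric_fps a = 1 + fps_const a * (fps_X * geometric_fps a)"
    using geometric_fps_mult[of a] by (simp add: algebra_simps)
  have "geometric_fps a * G * fps_exp y =
      G * fps_exp y + fps_const a * (fps_X * (geometric_fps a * G * fps_exp y))"
    by (subst *) (simp add: algebra_simps)
  then have "(geometric_fps a * G * fps_exp y) $$ Suc d =
      (G * fps_exp y + fps_const a * (fps_X * (geometric_fps a * G * fps_exp y))) $$ Suc d"
    by simp
  then show ?thesis
    unfolding appell_def by (simp del: fps_mult_nth)
qed

text \<open>
  Divided by its leading power, the polynomial tends to its leading coefficient \<open>G $$ 0 / fact d\<close>.
\<close>

lemma appell_at_top:
  assumes "even d" "d \<noteq> 0" "G $$ 0 > 0"
  shows "filterlim (appell d G) at_top at_infinity"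
proof -
  have "((\<lambda>y. \<Sum>k\<le>d. G $$ k / fact (d - k) * inverse y ^ k) \<longlongrightarrow>
      (\<Sum>k\<le>d. G $$ k / fact (d - k) * 0 ^ k)) at_infinity"
    by (intro tendsto_intros tendsto_inverse_0)
  also have "(\<Sum>k\<le>d. G $$ k / fact (d - k) * 0 ^ k) = G $$ 0 / fact d"
    by (subst sum.remove[of _ 0]) (auto intro!: sum.neutral)
  finally have lim: "((\<lambda>y. \<Sum>k\<le>d. G $$ k / fact (d - k) * inverse y ^ k) \<longlongrightarrow> G $$ 0 / fact d) at_infinity" .
  have "filterlim (\<lambda>y::real. norm y ^ d) at_top at_infinity"
    using assms by (intro filterlim_pow_at_top filterlim_norm_at_top) simp
  then have "filterlim (\<lambda>y::real. y ^ d) at_top at_infinity"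
    using assms by (simp add: power_even_abs)
  from filterlim_at_top_mult_tendsto_pos[OF lim _ this] assms
  have "filterlim (\<lambda>y. y ^ d * (\<Sum>k\<le>d. G $$ k / fact (d - k) * inverse y ^ k)) at_top at_infinity"
    by simp
  moreover have "\<forall>\<^sub>F y in at_infinity. y ^ d * (\<Sum>k\<le>d. G $$ k / fact (d - k) * inverse y ^ k) = appell d G y"
    unfolding eventually_at_infinity
  proof (intro exI allI impI)
    fix y :: real assume "1 \<le> norm y"
    then have "y \<noteq> 0" by auto
    then show "y ^ d * (\<Sum>k\<le>d. G $$ k / fact (d - k) * inverse y ^ k) = appell d G y"
      unfolding appell_eq_sum sum_distrib_left
      by (intro sum.cong refl) (simp add: power_diff field_simps)
  qed
  ultimately show ?thesis
    by (rule filterlim_cong[THEN iffD1, OF refl refl, rotated])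
qed

lemma attains_global_inf:
  fixes f :: "real \<Rightarrow> real"
  assumes "continuous_on UNIV f" and "filterlim f at_top at_infinity"
  shows "\<exists>y0. \<forall>y. f y0 \<le> f y"
proof -
  have "\<forall>\<^sub>F y in at_infinity. f 0 \<le> f y"
    using assms(2) by (simp add: filterlim_at_top)
  then obtain b where b: "\<And>y. b \<le> norm y \<Longrightarrow> f 0 \<le> f y"
    by (auto simp: eventually_at_infinity)
  have "\<exists>y0\<in>cball 0 \<bar>b\<bar>. \<forall>y\<in>cball 0 \<bar>b\<bar>. f y0 \<le> f y"
    using assms(1) by (intro continuous_attains_inf) (auto intro: continuous_on_subset)
  then obtain y0 where y0: "\<And>y. y \<in> cball 0 \<bar>b\<bar> \<Longrightarrow> f y0 \<le> f y"
    by blast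
  have "f y0 \<le> f y" for y
  proof (cases "y \<in> cball 0 \<bar>b\<bar>")
    case False
    then have "f 0 \<le> f y" by (intro b) auto
    moreover have "f y0 \<le> f 0" by (rule y0) simp
    ultimately show ?thesis by simp
  qed (rule y0)
  then show ?thesis by blast
qed

text \<open>
  At a global minimum of the new polynomial its derivative vanishes, so \<open>appell_geometric\<close> says that the
  two polynomials agree there.
\<close>

lemma appell_geometric_minimum:
  assumes "even d" "d \<noteq> 0" "G $$ 0 > 0"
  obtains y0 where "\<And>y. appell d (geometric_fps a * G) y0 \<le> appell d (geometric_fps a * G) y"
    and "appell d (geometric_fps a * G) y0 = appell d G y0"
proof -
  let ?q = "appell d (geometric_fps a * G)"
  obtain m where m: "d = Suc m"
    using assms(2) not0_implies_Suc by blast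
  have deriv: "(?q has_real_derivative appell m (geometric_fps a * G) y) (at y)" for y
    unfolding m by (rule appell_has_derivative)
  have "continuous_on UNIV ?q"
    using deriv by (meson DERIV_isCont continuous_at_imp_continuous_on)
  moreover have "filterlim ?q at_top at_infinity"
    using assms by (intro appell_at_top) (simp_all add: geometric_fps_nth_0)
  ultimately obtain y0 where y0: "\<And>y. ?q y0 \<le> ?q y"
    using attains_global_inf by blast
  have "appell m (geometric_fps a * G) y0 = 0"
    by (rule DERIV_local_min[OF deriv, where d = 1]) (use y0 in auto)
  then have "?q y0 = appell d G y0"
    unfolding m by (simp add: appell_geometric)
  with y0 show ?thesis by (rule that)
qed

lemma appell_geometric_pos:
  assumes "even d" "d \<noteq> 0" "G $$ 0 > 0" "\<And>y. appell d G y > 0"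
  shows "appell d (geometric_fps a * G) y > 0"
  using appell_geometric_minimum[OF assms(1-3), of a] assms(4) by (metis less_le_trans)

text \<open>
  This starts the induction. The polynomial \<open>y ^ d / fact d\<close> belonging to \<open>G = 1\<close> has a zero
  at \<open>0\<close>, so \<open>appell_geometric_pos\<close> does not apply to it; the hypothesis \<open>a \<noteq> 0\<close>
  rules out that the minimum sits at this zero.
\<close>

lemma appell_single_geometric_pos:
  assumes "even d" "d \<noteq> 0" "a \<noteq> 0"
  shows "appell d (geometric_fps a) y > 0"
proof -
  obtain y0 where min: "\<And>y. appell d (geometric_fps a) y0 \<le> appell d (geometric_fps a) y"
    and y0: "appell d (geometric_fps a) y0 = y0 ^ d / fact d"
    using appell_geometric_minimum[of d 1 a] assms by (auto simp: appell_1)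
  have "appell d (geometric_fps a) y0 > 0"
  proof (cases "y0 = 0")
    case True
    have "a ^ d > 0" using assms by (simp add: zero_less_power_eq)
    then show ?thesis by (simp add: True appell_0 geometric_fps_def)
  next
    case False
    then show ?thesis using assms by (simp add: y0 zero_less_power_eq)
  qed
  with min show ?thesis by (meson less_le_trans)
qed

text \<open>
  One factor with \<open>b \<noteq> 0\<close> is kept apart because it has to be multiplied in first; the
  other parameters \<open>a i\<close> may vanish. The exponents depend on \<open>i\<close> so that the separated
  factor can be taken from any of the powers.
\<close>

lemma geometric_product_nth_pos:
  assumes "even d" "d \<noteq> 0" "finite S" "b \<noteq> 0"
  shows "(geometric_fps b * (\<Prod>i\<in>S. geometric_fps (a i) ^ m i)) $$ d > 0"
proof -
  have mult_power: "(geometric_fps c ^ n * G) $$ 0 = 1 \<and> (\<forall>y. appell d (geometric_fps c ^ n * G) y > 0)"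
    if "G $$ 0 = 1" "\<forall>y. appell d G y > 0" for c n G
    using that
  proof (induction n)
    case (Suc n)
    have "appell d (geometric_fps c * (geometric_fps c ^ n * G)) y > 0" for y
      using Suc assms by (intro appell_geometric_pos) auto
    then show ?case
      using Suc by (simp add: mult.assoc geometric_fps_nth_0 fps_power_zeroth)
  qed simp
  have "(geometric_fps b * (\<Prod>i\<in>S. geometric_fps (a i) ^ m i)) $$ 0 = 1 \<and>
      (\<forall>y. appell d (geometric_fps b * (\<Prod>i\<in>S. geometric_fps (a i) ^ m i)) y > 0)"
    using assms(3)
  proof (induction S)
    case empty
    show ?case
      using assms by (simp add: geometric_fps_nth_0 appell_single_geometric_pos)
  next
    case (insert i S)
    show ?case
      using mult_power[OF conjunct1[OF insert.IH] conjunct2[OF insert.IH], of "a i" "m i"] insert.hyps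
      by (simp add: mult.left_commute)
  qed
  then show ?thesis
    by (metis appell_0)
qed

section \<open>The generating function of complete homogeneous polynomials\<close>

lemma geometric_prod_nth:
  fixes x :: "real ^ 'n"
  shows "(\<Prod>i\<in>UNIV. geometric_fps (x $ i)) $$ k = complete_homogeneous k x"
proof -
  have "(\<Prod>i\<in>UNIV. geometric_fps (x $ i)) $$ k =
      (\<Sum>X\<in>multisets_of_size UNIV k. \<Prod>i\<in>UNIV. (x $ i) ^ count X i)"
    by (simp add: fps_prod_nth' geometric_fps_def)
  also have "\<dots> = complete_homogeneous k x"
    unfolding complete_homogeneous_def
  proof (rule sum.reindex_bij_witness[where i = Abs_multiset and j = count])
    have cnt: "count (Abs_multiset a) = a" for a :: "'n \<Rightarrow> nat"
      by (simp add: count_Abs_multiset)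
    have size: "size X = (\<Sum>i\<in>UNIV. count X i)" for X :: "'n multiset"
      unfolding size_multiset_overloaded_eq
      by (rule sum.mono_neutral_left) (auto simp: not_in_iff)
    show "Abs_multiset a \<in> multisets_of_size UNIV k"
      if "a \<in> {a. (\<Sum>i\<in>UNIV. a i) = k}" for a :: "'n \<Rightarrow> nat"
      using that by (simp add: multisets_of_size_def size cnt)
    show "count X \<in> {a. (\<Sum>i\<in>UNIV. a i) = k}"
      if "X \<in> multisets_of_size UNIV k" for X :: "'n multiset"
      using that by (simp add: multisets_of_size_def size)
    show "count (Abs_multiset a) = a" for a :: "'n \<Rightarrow> nat" by (rule cnt)
  qed (simp_all add: count_inverse)
  finally show ?thesis .
qed

text \<open>
  Padded with zeros to length \<open>\<alpha>\<close>, the partition becomes a multiset in which \<open>0\<close> has multiplicity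
  \<open>\<alpha> - length \<pi>\<close>. This accounts for the first factor in the denominator of the coefficient,
  which is therefore a multinomial coefficient.
\<close>

lemma partition_coeff_eq_card:
  assumes "0 \<notin> set \<pi>" "length \<pi> \<le> \<alpha>"
  shows "partition_coeff \<alpha> \<pi> =
    card (permutations_of_multiset (mset \<pi> + replicate_mset (\<alpha> - length \<pi>) 0))"
proof -
  let ?A = "mset \<pi> + replicate_mset (\<alpha> - length \<pi>) 0"
  have "(\<Prod>i\<in>set_mset ?A. fact (count ?A i) :: nat) = (\<Prod>i\<in>insert 0 (set \<pi>). fact (count ?A i))"
  proof (rule prod.mono_neutral_left)
    show "\<forall>i\<in>insert 0 (set \<pi>) - set_mset ?A. fact (count ?A i) = (1 :: nat)"
      by (metis DiffD2 count_eq_zero_iff fact_0)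
  qed (auto split: if_splits)
  also have "\<dots> = fact (\<alpha> - length \<pi>) * (\<Prod>i\<in>set \<pi>. fact (count ?A i))"
    using assms by (simp add: count_mset)
  also have "(\<Prod>i\<in>set \<pi>. fact (count ?A i)) = (\<Prod>i\<in>set \<pi>. fact (count_list \<pi> i) :: nat)"
    using assms by (intro prod.cong refl) (auto simp: count_mset)
  finally have "card (permutations_of_multiset ?A) *
      (fact (\<alpha> - length \<pi>) * (\<Prod>i\<in>set \<pi>. fact (count_list \<pi> i))) = fact (size ?A)"
    using card_permutations_of_multiset_aux[of ?A] by simp
  also have "size ?A = \<alpha>" using assms by simp
  finally have "real (card (permutations_of_multiset ?A) *
      (fact (\<alpha> - length \<pi>) * (\<Prod>i\<in>set \<pi>. fact (count_list \<pi> i)))) = real (fact \<alpha>)"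
    by simp
  then have "real (card (permutations_of_multiset ?A)) *
      (fact (\<alpha> - length \<pi>) * (\<Prod>i\<in>set \<pi>. fact (count_list \<pi> i))) = fact \<alpha>"
    by simp
  then show ?thesis
    by (simp add: partition_coeff_def field_simps)
qed

text \<open>
  The coefficient of a power is a sum over all lists of \<open>\<alpha>\<close> exponents with sum \<open>d\<close>. Zero exponents
  contribute the factor \<open>F $$ 0 = 1\<close>, so the summand depends only on the partition formed by the
  nonzero exponents, and the lists with the same partition are the permutations counted by
  \<open>partition_coeff_eq_card\<close>.
\<close>

lemma fps_power_nth_partitions:
  fixes F :: "real fps"
  assumes "F $$ 0 = 1" "\<alpha> \<noteq> 0"
  shows "(F ^ \<alpha>) $$ d = (\<Sum>\<pi> | partition_of \<pi> d \<and> length \<pi> \<le> \<alpha>.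
    partition_coeff \<alpha> \<pi> * (\<Prod>p\<leftarrow>\<pi>. F $$ p))"
proof -
  define parts :: "nat list \<Rightarrow> nat list" where "parts v = rev (sort (filter (\<lambda>p. p \<noteq> 0) v))" for v
  let ?P = "{\<pi>. partition_of \<pi> d \<and> length \<pi> \<le> \<alpha>}"
  have "(F ^ \<alpha>) $$ d = (\<Sum>v\<in>natpermute d \<alpha>. \<Prod>j\<in>{0..\<alpha> - 1}. F $$ (v ! j))"
    using assms(2) by (simp add: fps_power_nth)
  also have "\<dots> = (\<Sum>v\<in>natpermute d \<alpha>. \<Prod>p\<leftarrow>v. F $$ p)"
  proof (rule sum.cong[OF refl])
    fix v assume "v \<in> natpermute d \<alpha>"
    then have "length v = \<alpha>" by (simp add: natpermute_def)
    moreover have "{0..\<alpha> - 1} = {0..<\<alpha>}" using assms(2) by auto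
    ultimately show "(\<Prod>j\<in>{0..\<alpha> - 1}. F $$ (v ! j)) = (\<Prod>p\<leftarrow>v. F $$ p)"
      by (simp add: prod.list_conv_set_nth)
  qed
  also have "\<dots> = (\<Sum>\<pi>\<in>?P. \<Sum>v | v \<in> natpermute d \<alpha> \<and> parts v = \<pi>. \<Prod>p\<leftarrow>v. F $$ p)"
  proof (rule sum.group[symmetric])
    show "parts ` natpermute d \<alpha> \<subseteq> ?P"
    proof clarify
      fix v assume v: "v \<in> natpermute d \<alpha>"
      have "sum_list (parts v) = sum_list (filter (\<lambda>p. p \<noteq> 0) v)"
        unfolding parts_def by (metis mset_rev mset_sort sum_mset_sum_list)
      also have "\<dots> = sum_list v"
        by (induction v) auto
      finally show "partition_of (parts v) d \<and> length (parts v) \<le> \<alpha>"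
        using v by (auto simp: partition_of_def natpermute_def parts_def sorted_wrt_rev)
    qed
  qed (rule natpermute_finite finite_partitions)+
  also have "\<dots> = (\<Sum>\<pi>\<in>?P. partition_coeff \<alpha> \<pi> * (\<Prod>p\<leftarrow>\<pi>. F $$ p))"
  proof (rule sum.cong[OF refl])
    fix \<pi> assume "\<pi> \<in> ?P"
    then have pos: "0 \<notin> set \<pi>" and sorted: "sorted (rev \<pi>)" and sum: "sum_list \<pi> = d"
      and len: "length \<pi> \<le> \<alpha>"
      by (auto simp: partition_of_def sorted_wrt_rev)
    let ?A = "mset \<pi> + replicate_mset (\<alpha> - length \<pi>) 0"
    have fiber: "{v \<in> natpermute d \<alpha>. parts v = \<pi>} = permutations_of_multiset ?A"
    proof (intro equalityI subsetI)
      fix v assume v: "v \<in> {v \<in> natpermute d \<alpha>. parts v = \<pi>}"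
      then have "mset \<pi> = filter_mset (\<lambda>p. p \<noteq> 0) (mset v)"
        by (auto simp: parts_def)
      then have "mset v = mset \<pi> + filter_mset (\<lambda>p. p = 0) (mset v)"
        using multiset_partition[of "mset v" "\<lambda>p. p \<noteq> 0"] by simp
      also have "filter_mset (\<lambda>p. p = 0) (mset v) = replicate_mset (count (mset v) 0) 0"
        by (rule filter_eq_replicate_mset)
      finally have eq: "mset v = mset \<pi> + replicate_mset (count (mset v) 0) 0" .
      then have "size (mset v) = length \<pi> + count (mset v) 0"
        by (metis size_union size_mset size_replicate_mset)
      moreover have "size (mset v) = \<alpha>"
        using v by (simp add: natpermute_def)
      ultimately have "count (mset v) 0 = \<alpha> - length \<pi>"
        by linarith
      with eq show "v \<in> permutations_of_multiset ?A"
        by (simp add: permutations_of_multiset_def)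
    next
      fix v assume "v \<in> permutations_of_multiset ?A"
      then have v: "mset v = ?A" by (simp add: permutations_of_multiset_def)
      have "length v = \<alpha>" using len arg_cong[OF v, of size] by simp
      moreover have "sum_list v = d"
        using arg_cong[OF v, of sum_mset] by (simp add: sum_mset_sum_list sum)
      moreover have "parts v = \<pi>"
      proof -
        have "filter_mset (\<lambda>p. p \<noteq> 0) (mset \<pi>) = mset \<pi>"
          using pos by (subst filter_mset_eq_conv) (auto intro: gr0I)
        then have "mset (rev \<pi>) = mset (filter (\<lambda>p. p \<noteq> 0) v)"
          by (simp add: v)
        then have "sort (filter (\<lambda>p. p \<noteq> 0) v) = rev \<pi>"
          using sorted by (intro properties_for_sort) auto
        then show ?thesis by (simp add: parts_def)
      qed
      ultimately show "v \<in> {v \<in> natpermute d \<alpha>. parts v = \<pi>}"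
        by (simp add: natpermute_def)
    qed
    have "(\<Prod>p\<leftarrow>v. F $$ p) = (\<Prod>p\<leftarrow>\<pi>. F $$ p)" if "v \<in> permutations_of_multiset ?A" for v
    proof -
      have v: "mset v = ?A" using that by (simp add: permutations_of_multiset_def)
      have "(\<Prod>p\<leftarrow>v. F $$ p) = (\<Prod>p\<in>#mset v. F $$ p)"
        by (simp flip: prod_mset_prod_list)
      also have "\<dots> = (\<Prod>p\<in>#mset \<pi>. F $$ p)"
        by (simp add: v assms(1))
      also have "\<dots> = (\<Prod>p\<leftarrow>\<pi>. F $$ p)"
        by (simp flip: prod_mset_prod_list)
      finally show ?thesis .
    qed
    then have "(\<Sum>v | v \<in> natpermute d \<alpha> \<and> parts v = \<pi>. \<Prod>p\<leftarrow>v. F $$ p) =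
        card (permutations_of_multiset ?A) * (\<Prod>p\<leftarrow>\<pi>. F $$ p)"
      by (simp add: fiber)
    then show "(\<Sum>v | v \<in> natpermute d \<alpha> \<and> parts v = \<pi>. \<Prod>p\<leftarrow>v. F $$ p) =
        partition_coeff \<alpha> \<pi> * (\<Prod>p\<leftarrow>\<pi>. F $$ p)"
      using pos len by (simp add: partition_coeff_eq_card)
  qed
  finally show ?thesis .
qed

text \<open>
  For \<open>\<alpha> \<noteq> 0\<close> this identifies $H_{d,\alpha}$ with $h_d$ evaluated at the variables
  \<open>x $ i\<close>, each repeated \<open>\<alpha>\<close> times.
\<close>

lemma H_poly_eq_nth:
  fixes x :: "real ^ 'n"
  assumes "\<alpha> \<noteq> 0"
  shows "H_poly d \<alpha> x = (\<Prod>i\<in>UNIV. geometric_fps (x $ i) ^ \<alpha>) $$ d"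
proof -
  have "(\<Prod>i\<in>UNIV. geometric_fps (x $ i)) $$ 0 = 1"
    by (simp add: fps_prod_nth' geometric_fps_nth_0 multisets_of_size_0)
  from fps_power_nth_partitions[OF this assms, of d] show ?thesis
    by (simp add: H_poly_def complete_homogeneous_partition_def geometric_prod_nth prod_power_distrib)
qed

section \<open>Positive definiteness\<close>

lemma continuous_on_H_poly: "continuous_on S (H_poly d \<alpha>)"
proof -
  have h: "continuous_on S (complete_homogeneous k)" for k
    unfolding complete_homogeneous_def by (intro continuous_intros)
  have "continuous_on S (complete_homogeneous_partition \<pi>)" for \<pi>
    unfolding complete_homogeneous_partition_def
    by (induction \<pi>) (auto intro!: continuous_intros h)
  then show ?thesis
    unfolding H_poly_def by (intro continuous_intros)
qed

theorem theorem6: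
  fixes d \<alpha> :: nat
  assumes "even d" and "d \<ge> 2" and "\<alpha> \<ge> 1"
  shows "positive_definite (H_poly d \<alpha> :: real ^ 'n \<Rightarrow> real)"
  unfolding positive_definite_def
proof (intro conjI allI impI)
  show "continuous_on UNIV (H_poly d \<alpha> :: real ^ 'n \<Rightarrow> real)"
    by (rule continuous_on_H_poly)
next
  fix x :: "real ^ 'n" assume "x \<noteq> 0"
  then obtain j where j: "x $ j \<noteq> 0"
    by (auto simp: vec_eq_iff)
  (* one of the \<alpha> factors of the nonzero coordinate is split off *)
  define m where "m i = (if i = j then \<alpha> - 1 else \<alpha>)" for i
  have "geometric_fps (x $ j) * geometric_fps (x $ j) ^ (\<alpha> - 1) = geometric_fps (x $ j) ^ \<alpha>"
    using assms(3) by (simp flip: power_Suc)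
  then have "(\<Prod>i\<in>UNIV. geometric_fps (x $ i) ^ \<alpha>) =
      geometric_fps (x $ j) * (\<Prod>i\<in>UNIV. geometric_fps (x $ i) ^ m i)"
    by (simp add: prod.remove[of UNIV j] m_def mult.assoc[symmetric])
  then show "H_poly d \<alpha> x > 0"
    using geometric_product_nth_pos[of d UNIV "x $ j" "\<lambda>i. x $ i" m] assms j
    by (simp add: H_poly_eq_nth)
qed

end
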